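(* For $d$ odd, let $c_d$ denote the number of $d$-simplices in $\mathbf S_{2d+1,d}$. As $d$ grows (through odd integers), $$c_d\sim\frac{(\sqrt2+1)^d}{\sqrt d}\cdot\frac{2^{1/4}(1+\alpha)}{4\alpha\sqrt\pi},$$ where $\alpha=3-2\sqrt2$. Consequently, $\lim c_d^{1/d}=\sqrt2+1$.
   Context: For $d$ odd and $n\ge d+1$, set $m=\frac{d+1}2$. $\mathbf S_{n,d}$ is the pure $d$-dimensional simplicial complex on the $n$ vertices $1,\ldots,n$ (a subcomplex of a regular triangulation of the cyclic polytope with $n$ vertices in $\mathbb R^d$) whose $d$-simplices are the sets $\{i_1,i_1+1,i_2,i_2+1,\ldots,i_m,i_m+1\}$ with $1\le i_1$, $i_m\le n-1$, $i_{j+1}-i_j\ge2$ for $1\le j<m$, and such that for all $1\le j<m$ either $i_j$ is odd or $i_{j+1}-i_j>2$. *)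

theory Defs
  imports Complex_Main "HOL-Library.Landau_Symbols"
begin

text \<open>
  A facet is determined by indices \<open>i 1, \<dots>, i m\<close> with \<open>m = (d + 1) / 2\<close>; values of \<open>i\<close> outside
  \<open>{1..m}\<close> are irrelevant. The conditions \<open>i m \<le> n - 1\<close>, \<open>i (j + 1) - i j \<ge> 2\<close> and
  \<open>i (j + 1) - i j > 2\<close> are written additively to avoid truncated subtraction.
  The disjunction is inclusive.
\<close>

definition S_facets :: "nat \<Rightarrow> nat \<Rightarrow> nat set set" where
  "S_facets n d =
     (let m = (d + 1) div 2 in
      {\<sigma>. \<exists>i :: nat \<Rightarrow> nat.
         \<sigma> = (\<Union>j\<in>{1..m}. {i j, i j + 1}) \<and>
         1 \<le> i 1 \<and> i m + 1 \<le> n \<and>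
         (\<forall>j. 1 \<le> j \<and> j < m \<longrightarrow> i j + 2 \<le> i (j + 1)) \<and>
         (\<forall>j. 1 \<le> j \<and> j < m \<longrightarrow> odd (i j) \<or> i j + 2 < i (j + 1))})"

text \<open>The complex generated by the facets; as usual for abstract complexes, simplices are nonempty.\<close>

definition S_complex :: "nat \<Rightarrow> nat \<Rightarrow> nat set set" where
  "S_complex n d = {\<tau>. \<tau> \<noteq> {} \<and> (\<exists>\<sigma>\<in>S_facets n d. \<tau> \<subseteq> \<sigma>)}"

definition simplices_of_dim :: "nat \<Rightarrow> 'a set set \<Rightarrow> 'a set set" where
  "simplices_of_dim k K = {\<tau> \<in> K. finite \<tau> \<and> card \<tau> = k + 1}"

definition c_S :: "nat \<Rightarrow> nat" where
  "c_S d = card (simplices_of_dim d (S_complex (2 * d + 1) d))"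

definition odd_at_top :: "nat filter" where
  "odd_at_top = inf at_top (principal {d. odd d})"

end

theory Submission
  imports Defs "HOL-Computational_Algebra.Formal_Power_Series"
    "HOL-Probability.Probability" "HOL-Real_Asymp.Real_Asymp"
begin

unbundle fps_syntax

text \<open>
  Write \<open>d = 2 m - 1\<close>, so that \<open>n = 2 d + 1 = 4 m - 1\<close>. A facet is determined by the positions
  \<open>i\<^sub>1 < \<dots> < i\<^sub>m\<close> of its consecutive pairs. Subtracting \<open>2 (j - 1)\<close> from \<open>i\<^sub>j\<close> preserves parity and
  turns the positions into a multiset of size \<open>m\<close> in \<open>{1..2 m}\<close> in which the odd numbers may be
  repeated and the even ones may not. An odd number contributes \<open>1 / (1 - x)\<close> to the generating
  function and an even one contributes \<open>1 + x\<close>, so \<open>c\<^sub>d\<close> is the coefficient of \<open>x\<^sup>m\<close> in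
  \<open>((1 + x) / (1 - x))\<^sup>m\<close>. In the formal proof the same product comes out of a recursion on the
  largest position (\<open>card_starts_rec\<close>, \<open>card_starts_eq_fps_nth\<close>).

  Expanding \<open>(1 + 2 x / (1 - x))\<^sup>m\<close> shows that this coefficient is also the coefficient of \<open>x\<^sup>m\<close> in the
  polynomial \<open>(1 + 2 x)\<^sup>m (1 + x)\<^sup>m\<^sup>-\<^sup>1\<close> (\<open>fps_nth_diagonal\<close>). Extracting the latter by Cauchy's
  formula on the circle \<open>\<bar>x\<bar> = 1 / sqrt 2\<close>, which passes through the saddle point, leaves a real
  integrand (\<open>has_integral_diagonal_sum\<close>):
  \<open>2 \<pi> c\<^sub>d = \<integral> (3 + 2 sqrt 2 cos t)\<^sup>m\<^sup>-\<^sup>1 (2 + sqrt 2 cos t) dt\<close> over \<open>[-\<pi>, \<pi>]\<close>.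
  The base is positive and has its unique maximum \<open>3 + 2 sqrt 2 = (sqrt 2 + 1)\<^sup>2\<close> at \<open>t = 0\<close>, so
  Laplace's method applies: after the substitution \<open>t = s / sqrt (m - 1)\<close> dominated convergence
  replaces the normalized integrand by a Gaussian (\<open>laplace_cos\<close>). This gives the asymptotics of
  \<open>c\<^sub>d\<close>, and the limit of the \<open>d\<close>-th roots follows because the factor
  \<open>sqrt d\<close> and the constant disappear under \<open>d\<close>-th roots.
\<close>

section \<open>Facets as sets of starting points\<close>

text \<open>
  The sets \<open>{i\<^sub>1, \<dots>, i\<^sub>m}\<close> that define facets. The conditions on consecutive indices become
  conditions on pairs of elements: a gap of 1 is forbidden, and a gap of 2 is forbidden after an
  even number.
\<close>

definition starts :: "nat \<Rightarrow> nat \<Rightarrow> nat set set" where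
  "starts n m = {I. I \<subseteq> {1..<n} \<and> card I = m \<and>
     (\<forall>x\<in>I. x + 1 \<notin> I) \<and> (\<forall>x\<in>I. even x \<longrightarrow> x + 2 \<notin> I)}"

lemma starts_finite: "I \<in> starts n m \<Longrightarrow> finite I"
  unfolding starts_def using finite_subset by blast

lemma finite_starts: "finite (starts n m)"
  by (rule finite_subset[of _ "Pow {1..<n}"]) (auto simp: starts_def)

lemma card_facet: 
  assumes "I \<in> starts n m" shows "card (I \<union> Suc ` I) = 2 * m"
proof -
  have "I \<inter> Suc ` I = {}" using assms unfolding starts_def by auto
  then show ?thesis using assms starts_finite[OF assms]
    by (simp add: card_Un_disjoint card_image starts_def)
qed

text \<open>The \<open>m\<close> pairs are disjoint and lie in \<open>{1..n}\<close>.\<close>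

lemma starts_eq_empty:
  assumes "n < 2 * m" shows "starts n m = {}"
proof (rule ccontr)
  assume "starts n m \<noteq> {}"
  then obtain I where I: "I \<in> starts n m" by blast
  have "I \<union> Suc ` I \<subseteq> {1..n}" using I unfolding starts_def by auto
  then have "card (I \<union> Suc ` I) \<le> n" using card_mono[of "{1..n}"] by fastforce
  then show False using card_facet[OF I] assms by simp
qed

text \<open>
  Reading a facet from left to right recovers its starting points: a vertex is a starting point
  exactly when its predecessor is not one.
\<close>

lemma inj_on_facet: "inj_on (\<lambda>I. I \<union> Suc ` I) (starts n m)"
proof (rule inj_onI)
  fix I J assume I: "I \<in> starts n m" and J: "J \<in> starts n m"
    and eq: "I \<union> Suc ` I = J \<union> Suc ` J"
  have sep: "\<forall>y\<in>I. y + 1 \<notin> I" "\<forall>y\<in>J. y + 1 \<notin> J" using I J by (simp_all add: starts_def)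
  have "x \<in> I \<longleftrightarrow> x \<in> J" for x
  proof (induction x rule: less_induct)
    case (less x)
    have *: "x \<in> B" if "A \<union> Suc ` A = B \<union> Suc ` B" "\<And>y. y < x \<Longrightarrow> y \<in> A \<longleftrightarrow> y \<in> B"
      "x \<in> A" "\<forall>y\<in>A. y + 1 \<notin> A" for A B
    proof (rule ccontr)
      assume "x \<notin> B"
      with that(1,3) obtain y where "x = Suc y" "y \<in> B" by blast
      then have "y \<in> A" using that(2)[of y] by simp
      then show False using that(3,4) \<open>x = Suc y\<close> by simp
    qed
    show ?case
    proof
      assume "x \<in> I"
      then show "x \<in> J" using *[OF eq less.IH _ sep(1)] by simp
    next
      assume "x \<in> J"
      then show "x \<in> I" using *[OF eq[symmetric] less.IH[symmetric] _ sep(2)] by simp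
    qed
  qed
  then show "I = J" by blast
qed

text \<open>
  The gap conditions on consecutive indices propagate to all pairs of indices, because two gaps
  already add up to at least 4. Conversely the indices are the increasing enumeration of the set.
\<close>

lemma S_facets_eq:
  assumes m: "m = (d + 1) div 2" and pos: "m \<ge> 1"
  shows "S_facets n d = (\<lambda>I. I \<union> Suc ` I) ` starts n m"
proof (intro equalityI subsetI)
  fix \<sigma> assume "\<sigma> \<in> S_facets n d"
  then obtain i where \<sigma>: "\<sigma> = (\<Union>j\<in>{1..m}. {i j, i j + 1})" and i1: "1 \<le> i 1" and im: "i m + 1 \<le> n"
    and g2: "\<And>j. 1 \<le> j \<Longrightarrow> j < m \<Longrightarrow> i j + 2 \<le> i (j + 1)"
    and g3: "\<And>j. 1 \<le> j \<Longrightarrow> j < m \<Longrightarrow> odd (i j) \<or> i j + 2 < i (j + 1)"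
    unfolding S_facets_def Let_def m[symmetric] by blast
  have gap: "i j + 2 \<le> i k \<and> (odd (i j) \<or> i j + 2 < i k)" if "1 \<le> j" "j < k" "k \<le> m" for j k
    using that(2,3)
  proof (induction k)
    case (Suc k)
    show ?case
    proof (cases "j = k")
      case True then show ?thesis using g2[of j] g3[of j] that Suc.prems by simp
    next
      case False
      then have "j < k" "k \<le> m" using Suc.prems by simp_all
      then have "i j + 2 \<le> i k" using Suc.IH by blast
      moreover have "i k + 2 \<le> i (Suc k)" using g2[of k] that(1) \<open>j < k\<close> Suc.prems(2) by simp
      ultimately show ?thesis by simp
    qed
  qed simp
  have inj: "inj_on i {1..m}"
  proof (rule inj_onI)
    fix j k assume "j \<in> {1..m}" "k \<in> {1..m}" "i j = i k"
    then show "j = k" using gap[of j k] gap[of k j] by (cases j k rule: linorder_cases) auto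
  qed
  have lo: "1 \<le> i j" if "j \<in> {1..m}" for j
    using that i1 gap[of 1 j] by (cases "j = 1") auto
  have hi: "i j < n" if "j \<in> {1..m}" for j
    using that im gap[of j m] by (cases "j = m") auto
  have sep: "i k \<noteq> i j + 1 \<and> (even (i j) \<longrightarrow> i k \<noteq> i j + 2)" if "j \<in> {1..m}" "k \<in> {1..m}" for j k
    using that gap[of j k] gap[of k j] by (cases j k rule: linorder_cases) auto
  have "i ` {1..m} \<in> starts n m"
  proof -
    have "card (i ` {1..m}) = m" using card_image[OF inj] by simp
    moreover have "i ` {1..m} \<subseteq> {1..<n}" using lo hi by (simp add: image_subset_iff)
    moreover have "x + 1 \<notin> i ` {1..m} \<and> (even x \<longrightarrow> x + 2 \<notin> i ` {1..m})" if "x \<in> i ` {1..m}" for x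
      using that sep by (metis imageE)
    ultimately show ?thesis unfolding starts_def by simp
  qed
  moreover have "\<sigma> = i ` {1..m} \<union> Suc ` (i ` {1..m})"
    unfolding \<sigma> by auto
  ultimately show "\<sigma> \<in> (\<lambda>I. I \<union> Suc ` I) ` starts n m" by blast
next
  fix \<sigma> assume "\<sigma> \<in> (\<lambda>I. I \<union> Suc ` I) ` starts n m"
  then obtain I where I: "I \<in> starts n m" and \<sigma>: "\<sigma> = I \<union> Suc ` I" by blast
  define l where "l = sorted_list_of_set I"
  define i where "i j = l ! (j - 1)" for j
  have fin: "finite I" using starts_finite[OF I] .
  have len: "length l = m" using I fin by (simp add: l_def starts_def)
  have I_eq: "I = i ` {1..m}"
  proof -
    have "I = set l" using fin by (simp add: l_def)
    also have "\<dots> = (\<lambda>j. l ! j) ` {..<m}" using len by (auto simp: set_conv_nth)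
    also have "{..<m} = (\<lambda>j. j - 1) ` {1..m}" by force
    finally show ?thesis by (simp add: image_image i_def)
  qed
  have mem: "i j \<in> I" if "1 \<le> j" "j \<le> m" for j using that I_eq by auto
  have less: "i j < i (j + 1)" if "1 \<le> j" "j < m" for j
    using sorted_wrt_nth_less[of "(<)" l "j - 1" j] that len
    by (simp add: i_def l_def)
  have "i j + 2 \<le> i (j + 1)" "odd (i j) \<or> i j + 2 < i (j + 1)" if "1 \<le> j" "j < m" for j
  proof -
    have *: "i j \<in> I" "i (j + 1) \<in> I" using mem that by simp_all
    have "i j + 1 \<notin> I" "even (i j) \<Longrightarrow> i j + 2 \<notin> I"
      using I *(1) unfolding starts_def by simp_all
    then have "i (j + 1) \<noteq> i j + 1" "even (i j) \<Longrightarrow> i (j + 1) \<noteq> i j + 2"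
      using *(2) by metis+
    then show "i j + 2 \<le> i (j + 1)" "odd (i j) \<or> i j + 2 < i (j + 1)"
      using less[OF that] by linarith+
  qed
  moreover have "1 \<le> i 1" "i m + 1 \<le> n" using mem[of 1] mem[of m] pos I unfolding starts_def by auto
  moreover have "\<sigma> = (\<Union>j\<in>{1..m}. {i j, i j + 1})" unfolding \<sigma> I_eq by auto
  ultimately show "\<sigma> \<in> S_facets n d" unfolding S_facets_def Let_def m[symmetric] by blast
qed

text \<open>
  All facets have the same number \<open>d + 1\<close> of vertices, so the faces of dimension \<open>d\<close> are the
  facets themselves.
\<close>

lemma c_S_eq_card_starts:
  assumes "m \<ge> 1"
  shows "c_S (2 * m - 1) = card (starts (4 * m - 1) m)"
proof -
  define d where "d = 2 * m - 1"
  have d: "m = (d + 1) div 2" "d + 1 = 2 * m" "2 * d + 1 = 4 * m - 1" using assms by (auto simp: d_def)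
  define F where "F = S_facets (2 * d + 1) d"
  have F: "F = (\<lambda>I. I \<union> Suc ` I) ` starts (2 * d + 1) m"
    unfolding F_def by (rule S_facets_eq) (use d assms in auto)
  have card_F: "finite \<sigma> \<and> card \<sigma> = d + 1" if "\<sigma> \<in> F" for \<sigma>
    using that card_facet starts_finite d(2) unfolding F by fastforce
  have "simplices_of_dim d (S_complex (2 * d + 1) d) = F"
  proof (intro equalityI subsetI)
    fix \<tau> assume "\<tau> \<in> simplices_of_dim d (S_complex (2 * d + 1) d)"
    then obtain \<sigma> where "\<sigma> \<in> F" "\<tau> \<subseteq> \<sigma>" "card \<tau> = d + 1"
      unfolding simplices_of_dim_def S_complex_def F_def by blast
    then show "\<tau> \<in> F" using card_F[of \<sigma>] card_subset_eq[of \<sigma> \<tau>] by auto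
  next
    fix \<tau> assume "\<tau> \<in> F"
    then show "\<tau> \<in> simplices_of_dim d (S_complex (2 * d + 1) d)"
      using card_F[of \<tau>] unfolding simplices_of_dim_def S_complex_def F_def by auto
  qed
  then have "c_S d = card F" by (simp add: c_S_def)
  then show ?thesis using card_image[OF inj_on_facet] unfolding F d_def[symmetric] d(3) by simp
qed

section \<open>The generating function\<close>

text \<open>
  The second summand counts the sets that contain the largest admissible position \<open>e\<close>: the next
  lower position is then at most \<open>e - 2\<close>, and at most \<open>e - 3\<close> if \<open>e\<close> is even, since a position
  \<open>e - 2\<close> would be even as well. For \<open>e = 1\<close> and \<open>e = 2\<close> both bounds leave no room, which agrees
  with truncated subtraction.
\<close>

lemma card_starts_rec:
  assumes "e \<ge> 1"
  shows "card (starts (e + 1) (Suc m)) =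
    card (starts e (Suc m)) + card (starts (if odd e then e - 1 else e - 2) m)"
proof -
  define b where "b = (if odd e then e - 1 else e - 2)"
  have notin: "e \<notin> I" if "I \<in> starts b m" for I
  proof -
    have "I \<subseteq> {1..<b}" "b \<le> e" using that by (auto simp: starts_def b_def)
    then show ?thesis by auto
  qed
  have "starts (e + 1) (Suc m) = starts e (Suc m) \<union> insert e ` starts b m"
  proof (intro equalityI subsetI)
    fix I assume I: "I \<in> starts (e + 1) (Suc m)"
    show "I \<in> starts e (Suc m) \<union> insert e ` starts b m"
    proof (cases "e \<in> I")
      case False
      then have "I \<in> starts e (Suc m)"
        using I unfolding starts_def by (auto simp: less_Suc_eq subset_iff)
      then show ?thesis ..
    next
      case True
      have lt: "x < b" if x: "x \<in> I" "x \<noteq> e" for x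
      proof -
        have "x < e" "x \<ge> 1" "x + 1 \<noteq> e" using x I True unfolding starts_def by auto
        moreover have "x + 2 \<noteq> e" if "even e"
          using x I True that unfolding starts_def by auto
        ultimately show ?thesis unfolding b_def by (cases "odd e") auto
      qed
      have "card (I - {e}) = m" using I True starts_finite[OF I] by (simp add: starts_def)
      then have "I - {e} \<in> starts b m"
        using I lt unfolding starts_def by (auto simp: subset_iff)
      then show ?thesis using True by (metis UnI2 imageI insert_Diff)
    qed
  next
    fix I assume "I \<in> starts e (Suc m) \<union> insert e ` starts b m"
    then show "I \<in> starts (e + 1) (Suc m)"
    proof
      assume "I \<in> starts e (Suc m)"
      then show ?thesis unfolding starts_def by (auto simp: subset_iff less_SucI)
    next
      assume "I \<in> insert e ` starts b m"
      then obtain I' where I': "I' \<in> starts b m" and I: "I = insert e I'" by blast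
      have "card I = Suc m" using I I' notin starts_finite[OF I'] by (simp add: starts_def)
      moreover have "x < e \<and> x + 1 \<noteq> e \<and> (even x \<longrightarrow> x + 2 \<noteq> e) \<and> x \<ge> 1" if "x \<in> I'" for x
      proof -
        have "x \<ge> 1" "x < b" using that I' unfolding starts_def by auto
        then show ?thesis unfolding b_def by (cases "odd e") auto
      qed
      ultimately show ?thesis using I' assms unfolding I starts_def by fastforce
    qed
  qed
  moreover have "starts e (Suc m) \<inter> insert e ` starts b m = {}"
    unfolding starts_def by auto
  moreover have "inj_on (insert e) (starts b m)"
    by (rule inj_onI) (metis notin Diff_insert_absorb)
  ultimately show ?thesis unfolding b_def[symmetric]
    by (simp add: card_Un_disjoint finite_starts card_image)
qed


text \<open>
  Here \<open>p\<close> is the range that remains after the positions are compressed by \<open>2 (j - 1)\<close>; among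
  \<open>1, \<dots>, p\<close> there are \<open>p div 2\<close> even and \<open>(p + 1) div 2\<close> odd numbers. Passing from \<open>p\<close> to
  \<open>p + 1\<close> multiplies the series by \<open>1 + X\<close> or by \<open>1 / (1 - X)\<close>, and the resulting recursions for the
  coefficients are the two cases of \<open>card_starts_rec\<close>.
\<close>

lemma card_starts_eq_fps_nth:
  assumes "n + 1 = p + 2 * m"
  shows "real (card (starts n m)) =
    ((1 + fps_X) ^ (p div 2) * inverse (1 - fps_X) ^ ((p + 1) div 2)) $ m"
  using assms
proof (induction p arbitrary: n m)
  case 0
  then show ?case using starts_eq_empty[of n m] by (cases m) auto
next
  case (Suc p)
  note IH = Suc.IH
  define G where "G p = ((1 + fps_X) ^ (p div 2) * inverse (1 - fps_X) ^ ((p + 1) div 2) :: real fps)" for p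
  have G_odd: "G p $ Suc m = G (Suc p) $ Suc m - G (Suc p) $ m" if "even p" for m
  proof -
    have "Suc p div 2 = p div 2" using that by presburger
    then have "G (Suc p) = G p * inverse (1 - fps_X)"
      by (simp add: G_def mult_ac)
    then have "G (Suc p) * (1 - fps_X) = G p"
      by (simp add: mult.assoc inverse_mult_eq_1)
    then have "G p = G (Suc p) - G (Suc p) * fps_X" by (simp add: algebra_simps)
    then show ?thesis by simp
  qed
  have G_even: "G (Suc p) $ Suc m = G p $ Suc m + G p $ m" if "odd p" for m
  proof -
    have "Suc p div 2 = Suc (p div 2)" using that by presburger
    then have "G (Suc p) = G p + G p * fps_X" by (simp add: G_def algebra_simps)
    then show ?thesis by simp
  qed
  show ?case using Suc.prems unfolding G_def[symmetric]
  proof (induction m arbitrary: n)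
    case 0
    have "I = {}" if "I \<in> starts n 0" for I
      using that starts_finite[OF that] by (simp add: starts_def)
    moreover have "{} \<in> starts n 0" by (simp add: starts_def)
    ultimately have "starts n 0 = {{}}" by blast
    then show ?case by (simp add: G_def fps_nth_power_0)
  next
    case (Suc m)
    define e where "e = p + 2 * m + 1"
    have n: "n = e + 1" using Suc.prems by (simp add: e_def)
    have 1: "card (starts e (Suc m)) = G p $ Suc m"
      using IH[of e "Suc m"] by (simp add: e_def G_def)
    show ?case
    (* The factor 1 / (1 - X) allows repetition, so in the first case the remaining elements are
       counted with the same range Suc p; in the second case the range drops to p. *)
    proof (cases "even p")
      case True
      have "card (starts (e - 1) m) = G (Suc p) $ m"
        using True by (intro Suc.IH) (simp add: e_def)
      then show ?thesis using card_starts_rec[of e m] 1 n True G_odd[of m] by (simp add: e_def)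
    next
      case False
      have "card (starts (e - 2) m) = G p $ m"
        using False unfolding G_def by (intro IH) (auto simp: e_def elim: oddE)
      then show ?thesis using card_starts_rec[of e m] 1 n False G_even[of m] by (simp add: e_def)
    qed
  qed
qed

text \<open>
  Since \<open>(1 + X) / (1 - X) = 1 + 2 X / (1 - X)\<close>, the binomial theorem applies, and the powers of
  \<open>1 / (1 - X)\<close> have known coefficients.
\<close>

lemma fps_nth_diagonal:
  assumes "m \<ge> 1"
  shows "((1 + fps_X) ^ m * inverse (1 - fps_X) ^ m) $ m =
    (\<Sum>k\<le>m. real (m choose k) * real ((m - 1) choose (m - k)) * 2 ^ k)"
proof -
  define v :: "real fps" where "v = inverse (1 - fps_X)"
  have v: "v * (1 - fps_X) = 1" by (simp add: v_def inverse_mult_eq_1)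
  have "(1 + fps_X) * v = v * (1 - fps_X) + 2 * fps_X * v" by (simp add: algebra_simps)
  then have "(1 + fps_X) ^ m * inverse (1 - fps_X) ^ m = (2 * fps_X * v + 1) ^ m"
    by (simp add: v power_mult_distrib[symmetric] add.commute flip: v_def)
  also have "\<dots> = (\<Sum>k\<le>m. fps_const (real (m choose k) * 2 ^ k) * (fps_X ^ k * v ^ k))"
    by (simp add: binomial_ring power_mult_distrib mult_ac flip: fps_of_nat fps_numeral_fps_const
        fps_const_power fps_const_mult)
  also have "\<dots> $ m = (\<Sum>k\<le>m. real (m choose k) * real ((m - 1) choose (m - k)) * 2 ^ k)"
    unfolding fps_sum_nth
  proof (intro sum.cong refl)
    fix k assume k: "k \<in> {..m}"
    have "(v ^ k) $ (m - k) = real ((m - 1) choose (m - k))"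
    proof (cases "k = 0")
      case True then show ?thesis using assms by (simp add: binomial_eq_0)
    next
      case False
      then have "v ^ k = Abs_fps (\<lambda>j. of_nat ((k + j - 1) choose j))"
        using one_minus_const_fps_X_neg_power'[of k "1::real"] by (simp add: v_def fps_inverse_power)
      then show ?thesis using k by simp
    qed
    then show "(fps_const (real (m choose k) * 2 ^ k) * (fps_X ^ k * v ^ k)) $ m =
      real (m choose k) * real ((m - 1) choose (m - k)) * 2 ^ k"
      using k by (simp add: fps_X_power_mult_nth)
  qed
  finally show ?thesis .
qed

lemma c_S_eq_sum:
  assumes "m \<ge> 1"
  shows "real (c_S (2 * m - 1)) =
    (\<Sum>k\<le>m. real (m choose k) * real ((m - 1) choose (m - k)) * 2 ^ k)"
  using card_starts_eq_fps_nth[of "4 * m - 1" "2 * m" m] fps_nth_diagonal[OF assms]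
    c_S_eq_card_starts[OF assms] assms
  by simp

section \<open>An integral representation\<close>

lemma has_integral_cis_int:
  fixes j :: int
  shows "((\<lambda>t. cis (of_int j * t)) has_integral (if j = 0 then 2 * complex_of_real pi else 0)) {-pi..pi}"
proof (cases "j = 0")
  case True
  have "((\<lambda>t::real. 1::complex) has_integral (pi - (-pi)) *\<^sub>R 1) {-pi..pi}"
    using has_integral_const_real[of "1::complex" "-pi" pi] by simp
  then show ?thesis using True by (simp add: scaleR_conv_of_real)
next
  case False
  define F where "F t = exp (\<i> * of_int j * of_real t) / (\<i> * of_int j)" for t :: real
  have "(F has_vector_derivative cis (of_int j * t)) (at t within {-pi..pi})" for t
  proof -
    have "((\<lambda>z. exp (\<i> * of_int j * z) / (\<i> * of_int j)) has_field_derivative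
        exp (\<i> * of_int j * of_real t)) (at (complex_of_real t))"
      using False by (auto intro!: derivative_eq_intros simp: divide_simps)
    then have "(F has_vector_derivative exp (\<i> * of_int j * of_real t)) (at t within {-pi..pi})"
      unfolding F_def by (rule has_vector_derivative_real_field)
    then show ?thesis by (simp add: cis_conv_exp mult.assoc)
  qed
  then have "((\<lambda>t. cis (of_int j * t)) has_integral (F pi - F (-pi))) {-pi..pi}"
    by (intro fundamental_theorem_of_calculus) auto
  moreover have "F pi - F (-pi) = 0"
  proof -
    have "F pi = cis (pi * of_int j) / (\<i> * of_int j)" "F (-pi) = cis (- (pi * of_int j)) / (\<i> * of_int j)"
      by (simp_all add: F_def cis_conv_exp mult_ac)
    moreover have "cis (pi * of_int j) = cis (- (pi * of_int j))"
      by (simp add: complex_eq_iff)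
    ultimately show ?thesis by simp
  qed
  ultimately show ?thesis using False by simp
qed

text \<open>Cauchy's coefficient formula on the circle of radius \<open>\<bar>r\<bar>\<close>.\<close>

lemma has_integral_poly_cis:
  fixes p :: "complex poly" and r :: complex
  shows "((\<lambda>t. poly p (r * cis t) * cis (- (real m * t))) has_integral
    2 * of_real pi * (coeff p m * r ^ m)) {-pi..pi}"
proof -
  have "((\<lambda>t. \<Sum>i\<le>degree p. (coeff p i * r ^ i) * cis (of_int (int i - int m) * t)) has_integral
      (\<Sum>i\<le>degree p. (coeff p i * r ^ i) *
         (if int i - int m = 0 then 2 * complex_of_real pi else 0))) {-pi..pi}"
    by (intro has_integral_sum has_integral_mult_right has_integral_cis_int) auto
  moreover have "(\<Sum>i\<le>degree p. (coeff p i * r ^ i) * cis (of_int (int i - int m) * t)) =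
      poly p (r * cis t) * cis (- (real m * t))" for t
  proof -
    have "cis (of_int (int i - int m) * t) = cis t ^ i * cis (- (real m * t))" for i
      by (simp only: Complex.DeMoivre cis_mult) (simp add: algebra_simps)
    then show ?thesis by (simp add: poly_altdef sum_distrib_right power_mult_distrib mult.assoc)
  qed
  moreover have "(\<Sum>i\<le>degree p. (coeff p i * r ^ i) *
         (if int i - int m = 0 then 2 * complex_of_real pi else 0)) =
      2 * of_real pi * (coeff p m * r ^ m)"
    by (simp add: if_distrib coeff_eq_0 cong: if_cong)
  ultimately show ?thesis by simp
qed

lemma coeff_power_one_linear: "coeff ([:1, c:] ^ n) i = of_nat (n choose i) * (c::complex) ^ i"
proof (cases "i \<le> n")
  case True
  then show ?thesis by (simp add: coeff_linear_poly_power)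
next
  case False
  have "degree ([:1, c:] ^ n) \<le> degree [:1, c:] * n" by (rule degree_power_le)
  also have "\<dots> \<le> 1 * n" by (rule mult_right_mono) auto
  finally show ?thesis using False by (simp add: coeff_eq_0)
qed

text \<open>
  The sum is the coefficient of \<open>x\<^sup>n\<^sup>+\<^sup>1\<close> in \<open>(1 + 2 x)\<^sup>n\<^sup>+\<^sup>1 (1 + x)\<^sup>n\<close>. The radius \<open>1 / sqrt 2\<close> makes
  \<open>(1 + 2 x) (1 + x) / x = 3 + 2 x + 1 / x\<close> real on the circle, and the one factor \<open>(1 + 2 x) / x\<close> that
  is left over contributes its real part only, because the integral is real.
\<close>

lemma has_integral_diagonal_sum:
  "((\<lambda>t. (3 + 2 * sqrt 2 * cos t) ^ n * (2 + sqrt 2 * cos t)) has_integral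
     2 * pi * (\<Sum>k\<le>Suc n. real (Suc n choose k) * real (n choose (Suc n - k)) * 2 ^ k)) {-pi..pi}"
proof -
  define S where "S = (\<Sum>k\<le>Suc n. real (Suc n choose k) * real (n choose (Suc n - k)) * 2 ^ k)"
  define p :: "complex poly" where "p = [:1, 2:] ^ Suc n * [:1, 1:] ^ n"
  define h where "h = complex_of_real (sqrt 2)"
  have h: "h * h = 2" "h \<noteq> 0" unfolding h_def by (simp_all flip: of_real_mult)
  have coeff: "coeff p (Suc n) = of_real S"
    unfolding p_def coeff_mult coeff_power_one_linear S_def by (simp add: mult_ac)
  have pw: "poly p (1 / h * cis t) * cis (- (real (Suc n) * t)) * h ^ Suc n =
    of_real ((3 + 2 * sqrt 2 * cos t) ^ n) * (2 + h * cis (- t))" for t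
  proof -
    have z: "cis t * cis (- t) = 1" by (simp add: cis_mult)
    have c: "h * cis (- t) + h * cis t = of_real (2 * sqrt 2 * cos t)"
      by (simp add: h_def complex_eq_iff)
    have "h * cis (- t) * ((1 + h * cis t) * (1 + cis t / h)) =
      h * cis (- t) + (cis t * cis (- t)) * (h * h + 1 + h * cis t)"
      using h(2) by (simp add: field_simps)
    also have "\<dots> = of_real (3 + 2 * sqrt 2 * cos t)"
      using c by (simp add: z h(1) algebra_simps)
    finally have 1: "h * cis (- t) * ((1 + h * cis t) * (1 + cis t / h)) = of_real (3 + 2 * sqrt 2 * cos t)" .
    have "h * cis (- t) * (1 + h * cis t) = h * cis (- t) + (h * h) * (cis t * cis (- t))"
      by (simp add: algebra_simps)
    then have 2: "h * cis (- t) * (1 + h * cis t) = 2 + h * cis (- t)" by (simp add: z h(1))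
    have "poly p x = (1 + 2 * x) ^ Suc n * (1 + x) ^ n" for x
      by (simp add: p_def mult.commute[of x] del: power_Suc)
    moreover have "2 * (1 / h * cis t) = h * cis t" using h by (simp add: field_simps)
    ultimately have "poly p (1 / h * cis t) = (1 + h * cis t) ^ Suc n * (1 + cis t / h) ^ n"
      by simp
    moreover have "cis (- (real (Suc n) * t)) = cis (- t) ^ Suc n"
      by (simp only: Complex.DeMoivre) simp
    ultimately have "poly p (1 / h * cis t) * cis (- (real (Suc n) * t)) * h ^ Suc n =
      (h * cis (- t) * ((1 + h * cis t) * (1 + cis t / h))) ^ n * (h * cis (- t) * (1 + h * cis t))"
      by (simp add: power_mult_distrib mult_ac)
    then show ?thesis unfolding 1 2 by simp
  qed
  have "((\<lambda>t. poly p (1 / h * cis t) * cis (- (real (Suc n) * t)) * h ^ Suc n) has_integral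
      2 * of_real pi * (coeff p (Suc n) * (1 / h) ^ Suc n) * h ^ Suc n) {-pi..pi}"
    by (intro has_integral_mult_left has_integral_poly_cis)
  moreover have "2 * of_real pi * (coeff p (Suc n) * (1 / h) ^ Suc n) * h ^ Suc n =
      complex_of_real (2 * pi * S)"
    using h(2) by (simp add: coeff power_divide del: power_Suc)
  ultimately have "((\<lambda>t. of_real ((3 + 2 * sqrt 2 * cos t) ^ n) * (2 + h * cis (- t))) has_integral
      complex_of_real (2 * pi * S)) {-pi..pi}"
    unfolding pw by simp
  from has_integral_linear[OF this bounded_linear_Re]
  show ?thesis unfolding o_def S_def[symmetric] by (simp add: h_def)
qed

section \<open>Laplace's method for powers of a cosine\<close>

text \<open>A crude form of Jordan's inequality, sufficient for a Gaussian bound on the integrand.\<close>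

lemma sin_ge_third:
  assumes "0 \<le> x" "x \<le> 2" shows "sin x \<ge> x / (3::real)"
proof -
  obtain t where t: "sin x = (\<Sum>k<3. sin_coeff k * x ^ k) + sin (t + 1 / 2 * real 3 * pi) / fact 3 * x ^ 3"
    using Maclaurin_sin_expansion[of x 3] by blast
  have "sin x = x + sin (t + 1 / 2 * real 3 * pi) * (x ^ 3 / 6)"
    unfolding t by (simp add: numeral_eq_Suc sin_coeff_def)
  moreover have "sin (t + 1 / 2 * real 3 * pi) * (x ^ 3 / 6) \<ge> (-1) * (x ^ 3 / 6)"
    using assms by (intro mult_right_mono) auto
  moreover have "x * x\<^sup>2 \<le> x * 2\<^sup>2"
    using assms by (intro mult_left_mono power_mono) auto
  moreover have "x * x\<^sup>2 = x ^ 3" "x * 2\<^sup>2 = 4 * x" by (simp_all add: power2_eq_square power3_eq_cube)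
  ultimately show ?thesis by linarith
qed

lemma one_minus_cos_ge:
  assumes "\<bar>t\<bar> \<le> pi" shows "1 - cos t \<ge> t\<^sup>2 / 18"
proof -
  have "sin (\<bar>t\<bar> / 2) \<ge> \<bar>t\<bar> / 2 / 3"
    using assms pi_half_less_two by (intro sin_ge_third) auto
  then have "(sin (\<bar>t\<bar> / 2))\<^sup>2 \<ge> (\<bar>t\<bar> / 2 / 3)\<^sup>2" by (intro power_mono) auto
  moreover have "1 - cos t = 2 * (sin (\<bar>t\<bar> / 2))\<^sup>2"
    using cos_double_sin[of "\<bar>t\<bar> / 2"] by simp
  ultimately show ?thesis by (simp add: power2_eq_square)
qed

text \<open>The integrand is a multiple of the centred normal density of variance \<open>1 / (2 c)\<close>.\<close>

lemma has_bochner_integral_gaussian: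
  assumes c: "c > (0::real)"
  shows "has_bochner_integral lborel (\<lambda>x. exp (- c * x\<^sup>2)) (sqrt (pi / c))"
proof -
  define \<sigma> where "\<sigma> = sqrt (1 / (2 * c))"
  have \<sigma>: "\<sigma> > 0" "\<sigma>\<^sup>2 = 1 / (2 * c)" using c by (auto simp: \<sigma>_def)
  have "has_bochner_integral lborel (normal_density 0 \<sigma>) 1"
    using integrable_normal_density[OF \<sigma>(1)] integral_normal_density[OF \<sigma>(1)]
    by (simp add: has_bochner_integral_iff)
  then have "has_bochner_integral lborel (\<lambda>x. sqrt (pi / c) * normal_density 0 \<sigma> x) (sqrt (pi / c) * 1)"
    by (rule has_bochner_integral_mult_right)
  moreover have "sqrt (pi / c) * normal_density 0 \<sigma> x = exp (- c * x\<^sup>2)" for x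
    using c by (simp add: normal_density_def \<sigma>(2) field_simps)
  ultimately show ?thesis by simp
qed

lemma cos_power_limit:
  fixes \<beta> s :: real
  assumes "\<beta> > 0"
  shows "(\<lambda>n. (1 - \<beta> * (1 - cos (s / sqrt (real (Suc n))))) ^ Suc n) \<longlonglongrightarrow> exp (- (\<beta> / 2) * s\<^sup>2)"
proof -
  (* The asymptotic expansion needs the sign of s; the cosine is even. *)
  have *: "(\<lambda>n. (1 - \<beta> * (1 - cos (s / sqrt (real (Suc n))))) ^ Suc n) \<longlonglongrightarrow> exp (- (\<beta> / 2) * s\<^sup>2)"
    if "s > 0" for s
    using assms that by real_asymp (simp add: power2_eq_square)
  consider "s > 0" | "s = 0" | "- s > 0" by linarith
  then show ?thesis using *[of s] *[of "- s"] by cases simp_all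
qed

text \<open>
  For \<open>\<beta> \<le> 1 / 2\<close> the base \<open>1 - \<beta> (1 - cos t)\<close> is nonnegative, and on \<open>[-\<pi>, \<pi>]\<close> it is at most
  \<open>exp (- \<beta> t\<^sup>2 / 18)\<close>. After the substitution \<open>t = s / sqrt n\<close> its \<open>n\<close>-th power is therefore bounded
  by one Gaussian for all \<open>n\<close>, while it converges pointwise to \<open>exp (- \<beta> s\<^sup>2 / 2)\<close>. The exponent
  \<open>Suc n\<close> excludes \<open>0\<close>, where the substitution degenerates.
\<close>

lemma laplace_cos:
  fixes \<beta> W :: real and w :: "real \<Rightarrow> real"
  assumes \<beta>: "\<beta> > 0" "\<beta> \<le> 1 / 2"
    and w: "continuous_on UNIV w" "\<And>t. \<bar>w t\<bar> \<le> W"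
  shows "(\<lambda>n. sqrt (real (Suc n)) *
      (LBINT t:{-pi..pi}. (1 - \<beta> * (1 - cos t)) ^ Suc n * w t))
    \<longlonglongrightarrow> w 0 * sqrt (2 * pi / \<beta>)"
proof -
  define q where "q t = 1 - \<beta> * (1 - cos t)" for t
  define r where "r n = sqrt (real (Suc n))" for n
  define f where "f n s = indicator {-pi..pi} (s / r n) * (q (s / r n) ^ Suc n * w (s / r n))" for n s
  have r_pos: "r n > 0" for n by (simp add: r_def)
  have w_meas [measurable]: "w \<in> borel_measurable borel"
    using w(1) by (rule borel_measurable_continuous_onI)
  have scale: "r n * (LBINT t:{-pi..pi}. q t ^ Suc n * w t) = (\<integral>s. f n s \<partial>lborel)" for n
    unfolding set_lebesgue_integral_def f_def
    using r_pos[of n] lborel_integral_real_affine[of "1 / r n"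
        "\<lambda>t. indicator {-pi..pi} t *\<^sub>R (q t ^ Suc n * w t)" 0]
    by simp
  have q_nonneg: "q t \<ge> 0" for t
  proof -
    have "\<beta> * (1 - cos t) \<le> 1 / 2 * 2" using \<beta> by (intro mult_mono) auto
    then show ?thesis by (simp add: q_def)
  qed
  have q_le: "q t \<le> exp (- (\<beta> / 18) * t\<^sup>2)" if "\<bar>t\<bar> \<le> pi" for t
  proof -
    have "\<beta> * (t\<^sup>2 / 18) \<le> \<beta> * (1 - cos t)"
      using one_minus_cos_ge[OF that] \<beta> by (intro mult_left_mono) auto
    then have "q t \<le> 1 + (- (\<beta> / 18) * t\<^sup>2)" by (simp add: q_def)
    also have "\<dots> \<le> exp (- (\<beta> / 18) * t\<^sup>2)" by (rule exp_ge_add_one_self)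
    finally show ?thesis .
  qed
  have bound: "norm (f n s) \<le> W * exp (- (\<beta> / 18) * s\<^sup>2)" for n s
  proof (cases "\<bar>s / r n\<bar> \<le> pi")
    case True
    have "q (s / r n) ^ Suc n \<le> exp (- (\<beta> / 18) * (s / r n)\<^sup>2) ^ Suc n"
      using q_le[OF True] q_nonneg by (intro power_mono)
    also have "\<dots> = exp (real (Suc n) * (- (\<beta> / 18) * (s / r n)\<^sup>2))"
      by (rule exp_of_nat_mult[symmetric])
    also have "real (Suc n) * (- (\<beta> / 18) * (s / r n)\<^sup>2) = - (\<beta> / 18) * s\<^sup>2"
      by (simp add: r_def power_divide del: of_nat_Suc)
    finally have "q (s / r n) ^ Suc n * \<bar>w (s / r n)\<bar> \<le> exp (- (\<beta> / 18) * s\<^sup>2) * W"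
      using w(2) by (intro mult_mono) auto
    moreover have "s / r n \<in> {-pi..pi}" by (metis True abs_le_iff atLeastAtMost_iff minus_le_iff)
    ultimately show ?thesis using q_nonneg by (simp add: f_def abs_mult mult.commute)
  next
    case False
    then have "s / r n \<notin> {-pi..pi}" by auto
    moreover have "W \<ge> 0" using w(2)[of 0] by linarith
    ultimately show ?thesis by (simp add: f_def)
  qed
  have lim: "(\<lambda>n. f n s) \<longlonglongrightarrow> w 0 * exp (- (\<beta> / 2) * s\<^sup>2)" for s
  proof -
    have to_0: "(\<lambda>n. s / r n) \<longlonglongrightarrow> 0" unfolding r_def by real_asymp
    then have "\<forall>\<^sub>F n in sequentially. s / r n \<in> {-pi<..<pi}"
      by (rule topological_tendstoD) auto
    then have "\<forall>\<^sub>F n in sequentially. q (s / r n) ^ Suc n * w (s / r n) = f n s"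
      by eventually_elim (auto simp: f_def)
    moreover have "(\<lambda>n. w (s / r n)) \<longlonglongrightarrow> w 0"
      by (rule continuous_on_tendsto_compose[OF w(1) to_0]) auto
    then have "(\<lambda>n. q (s / r n) ^ Suc n * w (s / r n)) \<longlonglongrightarrow> exp (- (\<beta> / 2) * s\<^sup>2) * w 0"
      unfolding q_def r_def by (intro tendsto_mult cos_power_limit \<beta>(1))
    ultimately show ?thesis by (auto simp: mult.commute dest: Lim_transform_eventually)
  qed
  have gauss: "has_bochner_integral lborel (\<lambda>s. w 0 * exp (- (\<beta> / 2) * s\<^sup>2)) (w 0 * sqrt (2 * pi / \<beta>))"
    using has_bochner_integral_mult_right[OF has_bochner_integral_gaussian[of "\<beta> / 2"], of "w 0"] \<beta>
    by (simp add: mult.commute)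
  have "(\<lambda>n. \<integral>s. f n s \<partial>lborel) \<longlonglongrightarrow> (\<integral>s. w 0 * exp (- (\<beta> / 2) * s\<^sup>2) \<partial>lborel)"
  proof (rule integral_dominated_convergence)
    show "integrable lborel (\<lambda>s. W * exp (- (\<beta> / 18) * s\<^sup>2))"
      using has_bochner_integral_gaussian[of "\<beta> / 18"] \<beta>
      by (intro integrable_mult_right) (auto simp: has_bochner_integral_iff)
    show "f n \<in> borel_measurable lborel" for n
      unfolding f_def q_def by measurable
  qed (use lim bound in auto)
  then show ?thesis
    unfolding has_bochner_integral_integral_eq[OF gauss] scale[symmetric] unfolding q_def r_def .
qed

section \<open>The asymptotics\<close>

text \<open>
  With \<open>d = 2 n + 1\<close> and \<open>B = (sqrt 2 + 1)\<^sup>2\<close> the normalizing power is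
  \<open>(sqrt 2 + 1)\<^sup>d = B\<^sup>n (sqrt 2 + 1)\<close>, and \<open>B\<^sup>n\<close> is the factor that normalizes the integrand to
  the value \<open>2 + sqrt 2\<close> at \<open>t = 0\<close>. The index starts at \<open>n = 1\<close> to match Laplace's method.
\<close>

lemma c_S_normalized_tendsto:
  "(\<lambda>N. real (c_S (2 * Suc N + 1)) * sqrt (real (2 * Suc N + 1)) / (sqrt 2 + 1) ^ (2 * Suc N + 1))
     \<longlonglongrightarrow> (sqrt 2 + 1) / (2 powr (1 / 4) * sqrt pi)"
proof -
  define B where "B = 3 + 2 * sqrt 2"
  (* This choice gives 3 + 2 sqrt 2 cos t = B (1 - \<beta> (1 - cos t)). *)
  define \<beta> where "\<beta> = 2 * sqrt 2 / B"
  define w where "w t = 2 + sqrt 2 * cos t" for t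
  define I where "I n = (LBINT t:{-pi..pi}. (1 - \<beta> * (1 - cos t)) ^ n * w t)" for n
  have B: "B > 0" "B = (sqrt 2 + 1)\<^sup>2" by (simp_all add: B_def add_pos_pos power2_sum)
  have "sqrt 2 \<le> 3 / 2" by (rule real_le_lsqrt) (auto simp: power2_eq_square)
  then have \<beta>: "\<beta> > 0" "\<beta> \<le> 1 / 2" using B(1) by (auto simp: \<beta>_def field_simps B_def)
  have c_eq: "real (c_S (2 * n + 1)) = B ^ n * I n / (2 * pi)" for n
  proof -
    have eq: "(3 + 2 * sqrt 2 * cos t) ^ n * w t = B ^ n * ((1 - \<beta> * (1 - cos t)) ^ n * w t)" for t
    proof -
      have "3 + 2 * sqrt 2 * cos t = B * (1 - \<beta> * (1 - cos t))"
        using B(1) by (simp add: \<beta>_def field_simps) (simp add: B_def algebra_simps)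
      then show ?thesis by (simp add: power_mult_distrib)
    qed
    have "set_integrable lborel {-pi..pi} (\<lambda>t. (1 - \<beta> * (1 - cos t)) ^ n * w t)"
      unfolding w_def by (intro borel_integrable_atLeastAtMost' continuous_intros)
    from set_borel_integral_eq_integral[OF this]
    have "((\<lambda>t. (1 - \<beta> * (1 - cos t)) ^ n * w t) has_integral I n) {-pi..pi}"
      by (simp add: I_def has_integral_integral)
    from has_integral_mult_right[OF this, of "B ^ n"]
    have "((\<lambda>t. (3 + 2 * sqrt 2 * cos t) ^ n * w t) has_integral B ^ n * I n) {-pi..pi}"
      unfolding eq .
    moreover have "((\<lambda>t. (3 + 2 * sqrt 2 * cos t) ^ n * w t) has_integral
        2 * pi * real (c_S (2 * n + 1))) {-pi..pi}"
      using has_integral_diagonal_sum[of n] c_S_eq_sum[of "Suc n"] by (simp add: w_def)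
    ultimately have "2 * pi * real (c_S (2 * n + 1)) = B ^ n * I n"
      by (rule has_integral_unique[rotated])
    then show ?thesis by (simp add: field_simps)
  qed
  have w_bound: "\<bar>w t\<bar> \<le> 2 + sqrt 2" for t
  proof -
    have "\<bar>sqrt 2 * cos t\<bar> \<le> sqrt 2" by (simp add: abs_mult)
    then show ?thesis unfolding w_def by linarith
  qed
  have lim_I: "(\<lambda>N. sqrt (real (Suc N)) * I (Suc N)) \<longlonglongrightarrow> w 0 * sqrt (2 * pi / \<beta>)"
    unfolding I_def using \<beta>
    by (intro laplace_cos[of _ _ "2 + sqrt 2"] w_bound) (auto simp: w_def intro!: continuous_intros)
  have lim_sqrt: "(\<lambda>N. sqrt (real (2 * Suc N + 1)) / sqrt (real (Suc N))) \<longlonglongrightarrow> sqrt 2"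
    by real_asymp (simp add: powr_half_sqrt)
  have "(\<lambda>N. sqrt (real (2 * Suc N + 1)) / sqrt (real (Suc N)) *
      (sqrt (real (Suc N)) * I (Suc N)) / (2 * pi * (sqrt 2 + 1)))
    \<longlonglongrightarrow> sqrt 2 * (w 0 * sqrt (2 * pi / \<beta>)) / (2 * pi * (sqrt 2 + 1))"
    by (intro tendsto_divide tendsto_mult[OF lim_sqrt lim_I] tendsto_const)
      (auto simp: add_nonneg_eq_0_iff)
  moreover have "sqrt (real (2 * Suc N + 1)) / sqrt (real (Suc N)) *
      (sqrt (real (Suc N)) * I (Suc N)) / (2 * pi * (sqrt 2 + 1)) =
    real (c_S (2 * Suc N + 1)) * sqrt (real (2 * Suc N + 1)) / (sqrt 2 + 1) ^ (2 * Suc N + 1)" for N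
  proof -
    have "(sqrt 2 + 1) ^ (2 * Suc N + 1) = B ^ Suc N * (sqrt 2 + 1)"
      unfolding B(2) by (simp only: power_add power_mult power_one_right)
    moreover have "sqrt 2 + 1 > (0::real)" by (simp add: add_pos_pos)
    ultimately show ?thesis unfolding c_eq using B(1)
      by (simp add: mult_ac del: power_Suc of_nat_Suc of_nat_add mult_Suc_right)
  qed
  moreover have "sqrt 2 * (w 0 * sqrt (2 * pi / \<beta>)) / (2 * pi * (sqrt 2 + 1)) =
    (sqrt 2 + 1) / (2 powr (1 / 4) * sqrt pi)"
  proof -
    define h where "h = sqrt 2"
    have h: "h > 0" "h * h = 2" by (simp_all add: h_def)
    have "2 * pi / \<beta> = pi * B / h" using h B(1) by (simp add: \<beta>_def h_def)
    also have "sqrt \<dots> = sqrt pi * (h + 1) / sqrt h"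
      using h(1) by (simp add: B(2) h_def real_sqrt_mult real_sqrt_divide)
    also have "sqrt h = 2 powr (1 / 4)"
      by (simp add: h_def powr_half_sqrt[symmetric] powr_powr)
    finally have 1: "sqrt (2 * pi / \<beta>) = sqrt pi * (h + 1) / 2 powr (1 / 4)" .
    have 2: "h * w 0 = 2 * (h + 1)" using h(2) by (simp add: w_def h_def[symmetric] algebra_simps)
    have 3: "pi = sqrt pi * sqrt pi" by simp
    have "h * (w 0 * sqrt (2 * pi / \<beta>)) / (2 * pi * (h + 1)) =
        (h * w 0) * (sqrt pi * (h + 1) / 2 powr (1 / 4)) / (2 * pi * (h + 1))"
      by (simp add: 1)
    also have "\<dots> = sqrt pi * (h + 1) / (2 powr (1 / 4) * pi)"
    proof -
      have "2 * g * (x / y) / (2 * pi * g) = x / (y * pi)" if "g > 0" for g x y :: real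
        using that by simp
      from this[of "h + 1"] show ?thesis unfolding 2 using h(1) by simp
    qed
    also have "\<dots> = (h + 1) / (2 powr (1 / 4) * sqrt pi)"
      by (subst 3) (simp del: real_sqrt_mult_self)
    finally show ?thesis unfolding h_def .
  qed
  ultimately show ?thesis by simp
qed

lemma tendsto_odd_at_topI:
  assumes "(\<lambda>N. f (2 * Suc N + 1)) \<longlonglongrightarrow> L"
  shows "(f \<longlongrightarrow> L) odd_at_top"
proof (rule topological_tendstoI)
  fix S assume "open S" "L \<in> S"
  with assms have "\<forall>\<^sub>F N in sequentially. f (2 * Suc N + 1) \<in> S"
    by (rule topological_tendstoD)
  then obtain M where M: "\<And>N. N \<ge> M \<Longrightarrow> f (2 * Suc N + 1) \<in> S"
    unfolding eventually_sequentially by blast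
  have "f d \<in> S" if d: "d \<ge> 2 * M + 3" "odd d" for d
  proof -
    obtain k where "d = 2 * k + 1" using d(2) by (rule oddE)
    then have "d = 2 * Suc (k - 1) + 1" "k - 1 \<ge> M" using d(1) by auto
    then show ?thesis using M by metis
  qed
  then show "\<forall>\<^sub>F d in odd_at_top. f d \<in> S"
    unfolding odd_at_top_def eventually_inf_principal eventually_at_top_linorder by auto
qed

theorem proposition5p8:
  fixes \<alpha> :: real
  assumes "\<alpha> = 3 - 2 * sqrt 2"
  shows "((\<lambda>d. real (c_S d)) \<sim>[odd_at_top]
            (\<lambda>d. (sqrt 2 + 1) ^ d / sqrt (real d) *
                 (2 powr (1 / 4) * (1 + \<alpha>) / (4 * \<alpha> * sqrt pi)))) \<and>
         ((\<lambda>d. real (c_S d) powr (1 / real d)) \<longlongrightarrow> sqrt 2 + 1) odd_at_top"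
proof -
  define K where "K = (sqrt 2 + 1) / (2 powr (1 / 4) * sqrt pi)"
  define u where "u d = real (c_S d) * sqrt (real d) / (sqrt 2 + 1) ^ d" for d
  have pos: "sqrt 2 + 1 > (0::real)" by (simp add: add_pos_pos)
  have K: "K > 0" using pos by (simp add: K_def)
  have K_eq: "2 powr (1 / 4) * (1 + \<alpha>) / (4 * \<alpha> * sqrt pi) = K"
  proof -
    (* Clearing denominators leaves sqrt 2 * (1 + \<alpha>) = 4 * \<alpha> * (sqrt 2 + 1). *)
    define p where "p = (2::real) powr (1 / 4)"
    have p: "p > 0" "p * p = sqrt 2"
      by (simp_all add: p_def powr_add[symmetric] powr_half_sqrt[symmetric])
    have "\<alpha> > 0"
    proof -
      have "sqrt 2 < 3 / 2" by (rule real_less_lsqrt) (auto simp: power2_eq_square)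
      then show ?thesis using assms by simp
    qed
    moreover have "p * p * (1 + \<alpha>) = 4 * \<alpha> * (sqrt 2 + 1)"
      unfolding p(2) assms by (simp add: algebra_simps)
    ultimately have "p * (1 + \<alpha>) / (4 * \<alpha>) = (sqrt 2 + 1) / p"
      using p(1) by (simp add: field_simps)
    then have "p * (1 + \<alpha>) / (4 * \<alpha>) / sqrt pi = (sqrt 2 + 1) / p / sqrt pi" by simp
    then show ?thesis unfolding K_def p_def[symmetric] by simp
  qed
  have u: "(u \<longlongrightarrow> K) odd_at_top"
    unfolding u_def K_def by (rule tendsto_odd_at_topI) (rule c_S_normalized_tendsto)
  have le: "odd_at_top \<le> at_top" by (simp add: odd_at_top_def)
  have d_pos: "\<forall>\<^sub>F d in odd_at_top. d > 0"
    using eventually_gt_at_top[of "0::nat"] le by (rule filter_leD[rotated])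
  have c: "\<forall>\<^sub>F d in odd_at_top. real (c_S d) = u d * ((sqrt 2 + 1) ^ d / sqrt (real d))"
    using d_pos by eventually_elim (use pos in \<open>simp add: u_def\<close>)
  have "((\<lambda>d. u d / K) \<longlongrightarrow> K / K) odd_at_top" by (intro tendsto_intros u) (use K in auto)
  moreover have "\<forall>\<^sub>F d in odd_at_top. u d / K = real (c_S d) / ((sqrt 2 + 1) ^ d / sqrt (real d) * K)"
    using c d_pos by eventually_elim (use pos in simp)
  ultimately have "((\<lambda>d. real (c_S d) / ((sqrt 2 + 1) ^ d / sqrt (real d) * K)) \<longlongrightarrow> 1) odd_at_top"
    using K by (auto dest: Lim_transform_eventually)
  then have "(\<lambda>d. real (c_S d)) \<sim>[odd_at_top] (\<lambda>d. (sqrt 2 + 1) ^ d / sqrt (real d) * K)"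
    by (rule asymp_equivI')
  moreover have "((\<lambda>d. real (c_S d) powr (1 / real d)) \<longlongrightarrow> sqrt 2 + 1) odd_at_top"
  proof -
    have "((\<lambda>d. 1 / real d) \<longlongrightarrow> 0) odd_at_top"
      by (rule tendsto_mono[OF le]) real_asymp
    moreover have "((\<lambda>d. sqrt (real d) powr (1 / real d)) \<longlongrightarrow> 1) odd_at_top"
      by (rule tendsto_mono[OF le]) real_asymp
    ultimately have "((\<lambda>d. u d powr (1 / real d) * ((sqrt 2 + 1) / sqrt (real d) powr (1 / real d)))
        \<longlongrightarrow> K powr 0 * ((sqrt 2 + 1) / 1)) odd_at_top"
      using K by (intro tendsto_intros u) auto
    moreover have "\<forall>\<^sub>F d in odd_at_top. u d powr (1 / real d) *
        ((sqrt 2 + 1) / sqrt (real d) powr (1 / real d)) = real (c_S d) powr (1 / real d)"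
      using c d_pos
    proof eventually_elim
      case (elim d)
      have "((sqrt 2 + 1) ^ d) powr (1 / real d) = sqrt 2 + 1"
        using pos elim(2) by (simp add: powr_realpow[symmetric] powr_powr)
      moreover have "u d \<ge> 0" using pos by (simp add: u_def)
      ultimately show ?case unfolding elim(1) using pos
        by (simp add: powr_mult powr_divide)
    qed
    ultimately show ?thesis using K by (auto dest: Lim_transform_eventually)
  qed
  ultimately show ?thesis unfolding K_eq by blast
qed

end
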